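(* Let $d\ge 1$ and $d_\circ>0$, and let $u, v \in [0,1]^d$ be nonzero vectors with $\lVert u\rVert_1\le 1$ and $\lVert v\rVert_1\le 1$. Let $h:\{1,\ldots,d\}\to[0,1]$ be a random hash function whose values $h(1),\ldots,h(d)$ are independent and uniformly distributed on $[0,1]$, and use the same $h$ to sketch both vectors. Define $\tau_u = d_\circ/\lVert u\rVert_1$, $\tau_v = d_\circ/\lVert v\rVert_1$, $K_u=\{ i : u_i\neq 0,\ h(i)\le \tau_u u_i\}$ and $K_v=\{ i : v_i\neq 0,\ h(i)\le \tau_v v_i\}$, and let $$W=\sum_{i\in K_u\cap K_v}\frac{u_i v_i}{\min(1, u_i\tau_u, v_i\tau_v)}.$$ Then $\mathbb{E}[W]=\langle u,v\rangle$ and $$\operatorname{Var}[W]\le \frac{1}{d_\circ}\,\langle u,v\rangle\,\big(\lVert u\rVert_1+\lVert v\rVert_1\big),$$ where expectation and variance are over the randomness of $h$.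
   Context: This is the "$\ell_1$ threshold sampling" sketch: for a vector $u$ with sketch size $d_\circ$, coordinate $i$ with $u_i\neq0$ is kept (its index put in $K_u$ and its value recorded) iff $h(i)\le d_\circ u_i/\lVert u\rVert_1$; the sketch also stores $\tau_u=d_\circ/\lVert u\rVert_1$. $W$ is the inner-product estimate computed from the sketches of $u$ and $v$. $\langle\cdot,\cdot\rangle$ is the standard inner product and $\lVert\cdot\rVert_1$ the $\ell_1$ norm. *)

theory Defs
  imports "HOL-Probability.Probability"
begin

definition l1_norm :: "real ^ 'n \<Rightarrow> real" where
  "l1_norm u = (\<Sum>i\<in>UNIV. \<bar>u $ i\<bar>)"

definition threshold :: "real \<Rightarrow> real ^ 'n \<Rightarrow> real" where
  "threshold d0 u = d0 / l1_norm u"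

text \<open>Here \<open>g\<close> is one realization of the random hash function.\<close>

definition kept :: "real \<Rightarrow> ('n \<Rightarrow> real) \<Rightarrow> real ^ 'n \<Rightarrow> 'n set" where
  "kept d0 g u = {i. u $ i \<noteq> 0 \<and> g i \<le> threshold d0 u * u $ i}"

definition ip_estimate :: "real \<Rightarrow> ('n \<Rightarrow> real) \<Rightarrow> real ^ 'n \<Rightarrow> real ^ 'n \<Rightarrow> real" where
  "ip_estimate d0 g u v =
     (\<Sum>i\<in>kept d0 g u \<inter> kept d0 g v.
        (u $ i * v $ i) / Min {1, u $ i * threshold d0 u, v $ i * threshold d0 v})"

end

theory Submission
  imports Defs
begin

text \<open>
  With \<open>p\<^sub>i = min(1, u\<^sub>i \<tau>\<^sub>u, v\<^sub>i \<tau>\<^sub>v)\<close>, coordinate \<open>i\<close> contributes to the estimate exactly when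
  \<open>h(i) \<le> p\<^sub>i\<close>, so the estimate is a sum of independent scaled Bernoulli variables with mean
  \<open>u\<^sub>i v\<^sub>i\<close> and variance \<open>(u\<^sub>i v\<^sub>i)\<^sup>2 (1 / p\<^sub>i - 1)\<close>. If \<open>p\<^sub>i < 1\<close>, then \<open>1 / p\<^sub>i\<close> is the larger of
  \<open>\<parallel>u\<parallel>\<^sub>1 / (d\<^sub>0 u\<^sub>i)\<close> and \<open>\<parallel>v\<parallel>\<^sub>1 / (d\<^sub>0 v\<^sub>i)\<close>; bounding it by their sum gives the claim coordinatewise.
\<close>

context prob_space
begin

text \<open>Expanding the square leaves a cross term \<open>2 * (X \<omega> * Y \<omega>)\<close>,
  whose mean factors by independence and cancels against the cross term of the squared mean. Square
  integrability of the sum is also concluded so that the result can be iterated.\<close>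

lemma variance_add_indep_var:
  fixes X Y :: "'a \<Rightarrow> real"
  assumes indep: "indep_var borel X borel Y"
    and X2: "integrable M (\<lambda>\<omega>. (X \<omega>)\<^sup>2)" and Y2: "integrable M (\<lambda>\<omega>. (Y \<omega>)\<^sup>2)"
  shows "integrable M (\<lambda>\<omega>. (X \<omega> + Y \<omega>)\<^sup>2)"
    and "variance (\<lambda>\<omega>. X \<omega> + Y \<omega>) = variance X + variance Y"
proof -
  have [measurable]: "X \<in> borel_measurable M" "Y \<in> borel_measurable M"
    using indep_var_rv1[OF indep] indep_var_rv2[OF indep] by auto
  have X: "integrable M X" and Y: "integrable M Y"
    by (rule square_integrable_imp_integrable[OF _ X2] square_integrable_imp_integrable[OF _ Y2],
        measurable)+
  have XY: "integrable M (\<lambda>\<omega>. X \<omega> * Y \<omega>)"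
    by (rule indep_var_integrable[OF indep X Y])
  have sq: "(\<lambda>\<omega>. (X \<omega> + Y \<omega>)\<^sup>2) = (\<lambda>\<omega>. (X \<omega>)\<^sup>2 + (Y \<omega>)\<^sup>2 + 2 * (X \<omega> * Y \<omega>))"
    by (simp add: power2_sum mult.assoc)
  show int: "integrable M (\<lambda>\<omega>. (X \<omega> + Y \<omega>)\<^sup>2)"
    unfolding sq using X2 Y2 XY by simp
  have "expectation (\<lambda>\<omega>. (X \<omega> + Y \<omega>)\<^sup>2) =
      expectation (\<lambda>\<omega>. (X \<omega>)\<^sup>2) + expectation (\<lambda>\<omega>. (Y \<omega>)\<^sup>2) + 2 * (expectation X * expectation Y)"
    unfolding sq using X2 Y2 XY by (simp add: indep_var_lebesgue_integral[OF indep X Y])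
  then show "variance (\<lambda>\<omega>. X \<omega> + Y \<omega>) = variance X + variance Y"
    by (subst (1 2 3) variance_eq) (use X Y X2 Y2 int in \<open>simp_all add: power2_sum\<close>)
qed

lemma variance_sum_indep_vars:
  fixes X :: "'i \<Rightarrow> 'a \<Rightarrow> real"
  assumes "finite I" and "indep_vars (\<lambda>_. borel) X I"
    and "\<And>i. i \<in> I \<Longrightarrow> integrable M (\<lambda>\<omega>. (X i \<omega>)\<^sup>2)"
  shows "variance (\<lambda>\<omega>. \<Sum>i\<in>I. X i \<omega>) = (\<Sum>i\<in>I. variance (X i))"
proof -
  \<comment> \<open>The induction carries square integrability of the partial sum along with the
    variance identity, because adding the next summand requires it.\<close>
  have "integrable M (\<lambda>\<omega>. (\<Sum>i\<in>I. X i \<omega>)\<^sup>2)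
      \<and> variance (\<lambda>\<omega>. \<Sum>i\<in>I. X i \<omega>) = (\<Sum>i\<in>I. variance (X i))"
    using assms
  proof (induction I rule: finite_induct)
    case (insert i I)
    have "indep_vars (\<lambda>_. borel) X I"
      using insert.prems(1) by (rule indep_vars_subset) auto
    with insert have IH: "integrable M (\<lambda>\<omega>. (\<Sum>i\<in>I. X i \<omega>)\<^sup>2)"
        "variance (\<lambda>\<omega>. \<Sum>i\<in>I. X i \<omega>) = (\<Sum>i\<in>I. variance (X i))"
      by auto
    have "integrable M (\<lambda>\<omega>. (X i \<omega>)\<^sup>2)"
      using insert.prems by auto
    from variance_add_indep_var[OF indep_vars_sum[OF insert.hyps insert.prems(1)] this IH(1)] IH(2)
    show ?case using insert.hyps by simp
  qed simp
  then show ?thesis ..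
qed

text \<open>An indicator equals its own square, so the second moment is again the mean of a scaled
  indicator, with \<open>c\<^sup>2\<close> in place of \<open>c\<close>.\<close>

lemma scaled_indicator_moments:
  fixes c :: real
  assumes A: "A \<in> events"
  shows "expectation (\<lambda>\<omega>. c * indicator A \<omega>) = c * prob A"
    and "variance (\<lambda>\<omega>. c * indicator A \<omega>) = c\<^sup>2 * prob A * (1 - prob A)"
    and "integrable M (\<lambda>\<omega>. (c * indicator A \<omega>)\<^sup>2)"
proof -
  have sq: "(\<lambda>\<omega>. (c * indicator A \<omega>)\<^sup>2) = (\<lambda>\<omega>. c\<^sup>2 * indicator A \<omega>)"
    by (auto simp: indicator_def)
  have int: "integrable M (\<lambda>\<omega>. k * indicator A \<omega> :: real)" for k
    using A by (simp add: less_top[symmetric])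
  have mean: "expectation (\<lambda>\<omega>. k * indicator A \<omega>) = k * prob A" for k
    using A by simp
  show "expectation (\<lambda>\<omega>. c * indicator A \<omega>) = c * prob A"
    by (rule mean)
  show int2: "integrable M (\<lambda>\<omega>. (c * indicator A \<omega>)\<^sup>2)"
    unfolding sq by (rule int)
  show "variance (\<lambda>\<omega>. c * indicator A \<omega>) = c\<^sup>2 * prob A * (1 - prob A)"
    unfolding variance_eq[OF int int2] unfolding sq mean
    by (simp add: power2_eq_square algebra_simps)
qed

lemma prob_uniform_le:
  fixes X :: "'a \<Rightarrow> real"
  assumes X: "X \<in> borel_measurable M"
    and unif: "distr M lborel X = uniform_measure lborel {0..1}" and p: "0 \<le> p" "p \<le> 1"
  shows "prob {\<omega> \<in> space M. X \<omega> \<le> p} = p"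
proof -
  have "prob {\<omega> \<in> space M. X \<omega> \<le> p} = measure (distr M lborel X) {..p}"
    using X by (subst measure_distr) (auto intro!: arg_cong[where f = prob])
  also have "\<dots> = measure lborel ({0..1} \<inter> {..p}) / measure lborel {0..1::real}"
    unfolding unif by (rule measure_uniform_measure) auto
  also have "{0..1} \<inter> {..p} = {0..p}"
    using p by auto
  finally show ?thesis
    using p by simp
qed

end

lemma l1_norm_pos: "u \<noteq> 0 \<Longrightarrow> 0 < l1_norm u"
proof -
  assume "u \<noteq> 0"
  then obtain i where "u $ i \<noteq> 0"
    by (auto simp: vec_eq_iff)
  then show ?thesis
    unfolding l1_norm_def by (intro sum_pos2[of UNIV i]) auto
qed

lemma threshold_pos: "0 < d0 \<Longrightarrow> u \<noteq> 0 \<Longrightarrow> 0 < threshold d0 u"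
  by (simp add: threshold_def l1_norm_pos)

text \<open>Both sketches share one hash value per coordinate, so the two acceptance tests amount to
  a single test against the smaller threshold. For nonnegative vectors with both entries nonzero,
  this is the probability that a uniform hash keeps the coordinate in both sketches.\<close>

definition keep_prob :: "real \<Rightarrow> real ^ 'n \<Rightarrow> real ^ 'n \<Rightarrow> 'n \<Rightarrow> real" where
  "keep_prob d0 u v i = Min {1, u $ i * threshold d0 u, v $ i * threshold d0 v}"

lemma keep_prob_le_1: "keep_prob d0 u v i \<le> 1"
  by (simp add: keep_prob_def)

lemma keep_prob_nonneg:
  assumes "0 < d0" "u \<noteq> 0" "v \<noteq> 0" "0 \<le> u $ i" "0 \<le> v $ i"
  shows "0 \<le> keep_prob d0 u v i"
  using assms by (simp add: keep_prob_def threshold_pos less_imp_le)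

lemma keep_prob_pos:
  assumes "0 < d0" "u \<noteq> 0" "v \<noteq> 0" "0 < u $ i" "0 < v $ i"
  shows "0 < keep_prob d0 u v i"
  using assms by (simp add: keep_prob_def threshold_pos)

text \<open>This replaces the random index set by a fixed one. An index outside the intersection
  adds nothing: either the product of its entries is 0, or its hash exceeds a threshold and the
  indicator vanishes. Inside the intersection, \<open>g i \<le> 1\<close> ensures that the cap 1 in
  \<open>keep_prob\<close> does not switch the indicator off.\<close>

lemma ip_estimate_eq_sum_indicator:
  fixes u v :: "real ^ 'n::finite"
  assumes "\<And>i. g i \<le> 1"
  shows "ip_estimate d0 g u v =
    (\<Sum>i\<in>UNIV. u $ i * v $ i / keep_prob d0 u v i * indicator {..keep_prob d0 u v i} (g i))"
proof -
  have "ip_estimate d0 g u v =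
      (\<Sum>i\<in>kept d0 g u \<inter> kept d0 g v. u $ i * v $ i / keep_prob d0 u v i)"
    by (simp add: ip_estimate_def keep_prob_def)
  also have "\<dots> = (\<Sum>i\<in>UNIV. u $ i * v $ i / keep_prob d0 u v i * indicator {..keep_prob d0 u v i} (g i))"
    by (rule sum.mono_neutral_cong_left)
      (use assms in \<open>auto simp: kept_def keep_prob_def indicator_def mult.commute\<close>)
  finally show ?thesis .
qed

lemma coordinate_variance_bound:
  fixes u v :: "real ^ 'n::finite"
  assumes d0: "0 < d0" and u: "u $ i \<in> {0..1}" and v: "v $ i \<in> {0..1}"
    and nz: "u \<noteq> 0" "v \<noteq> 0"
  defines "p \<equiv> keep_prob d0 u v i"
  shows "(u $ i * v $ i / p)\<^sup>2 * p * (1 - p) \<le> 1 / d0 * (u $ i * v $ i) * (l1_norm u + l1_norm v)"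
proof (cases "u $ i = 0 \<or> v $ i = 0")
  case False
  define a b where "a = u $ i" and "b = v $ i"
  have ab: "0 < a" "a \<le> 1" "0 < b" "b \<le> 1"
    using False u v by (auto simp: a_def b_def)
  have p: "0 < p" "p \<le> 1"
    using keep_prob_pos[OF d0 nz] keep_prob_le_1 ab by (auto simp: p_def a_def b_def)
  note norms = l1_norm_pos[OF nz(1)] l1_norm_pos[OF nz(2)]
  have cases: "p = 1 \<or> p = a * (d0 / l1_norm u) \<or> p = b * (d0 / l1_norm v)"
    by (auto simp: p_def keep_prob_def a_def b_def threshold_def min_def)
  \<comment> \<open>One factor \<open>a * b\<close> of the variance is set aside for the inner
    product; this bounds what remains.\<close>
  have "a * b * (1 / p - 1) \<le> (l1_norm u + l1_norm v) / d0"
    using cases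
  proof (elim disjE)
    assume "p = 1"
    then show ?thesis using norms d0 by simp
  next
    assume p_eq: "p = a * (d0 / l1_norm u)"
    \<comment> \<open>After dropping the -1, the entry attaining the minimum cancels. The other
      entry is at most 1, and the missing norm is positive, so it may be added.\<close>
    have "a * b * (1 / p - 1) \<le> a * b * (1 / p)"
      using ab by (intro mult_left_mono) auto
    also have "\<dots> = b * l1_norm u / d0"
      using ab norms d0 by (simp add: p_eq)
    also have "\<dots> \<le> (l1_norm u + l1_norm v) / d0"
      using ab norms d0 mult_right_mono[of b 1 "l1_norm u"] by (intro divide_right_mono) linarith+
    finally show ?thesis .
  next
    assume p_eq: "p = b * (d0 / l1_norm v)"
    have "a * b * (1 / p - 1) \<le> a * b * (1 / p)"
      using ab by (intro mult_left_mono) auto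
    also have "\<dots> = a * l1_norm v / d0"
      using ab norms d0 by (simp add: p_eq)
    also have "\<dots> \<le> (l1_norm u + l1_norm v) / d0"
      using ab norms d0 mult_right_mono[of a 1 "l1_norm v"] by (intro divide_right_mono) linarith+
    finally show ?thesis .
  qed
  then have "a * b * (a * b * (1 / p - 1)) \<le> a * b * ((l1_norm u + l1_norm v) / d0)"
    using ab by (intro mult_left_mono) auto
  moreover have "(a * b / p)\<^sup>2 * p * (1 - p) = a * b * (a * b * (1 / p - 1))"
    using p by (simp add: field_simps power2_eq_square)
  ultimately show ?thesis
    by (simp add: a_def b_def mult.commute)
qed auto

theorem theorem3p1:
  fixes M :: "'a measure" and h :: "'n::finite \<Rightarrow> 'a \<Rightarrow> real"
    and u v :: "real ^ 'n" and d0 :: real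
  assumes "prob_space M"
    and "d0 > 0"
    and "\<And>i. u $ i \<in> {0..1}" and "\<And>i. v $ i \<in> {0..1}"
    and "u \<noteq> 0" and "v \<noteq> 0"
    and "l1_norm u \<le> 1" and "l1_norm v \<le> 1"
    and "\<And>i \<omega>. \<omega> \<in> space M \<Longrightarrow> h i \<omega> \<in> {0..1}"
    and "prob_space.indep_vars M (\<lambda>_. borel) h UNIV"
    and "\<And>i. distr M lborel (h i) = uniform_measure lborel {0..1}"
  shows "prob_space.expectation M (\<lambda>\<omega>. ip_estimate d0 (\<lambda>i. h i \<omega>) u v) = u \<bullet> v
    \<and> prob_space.variance M (\<lambda>\<omega>. ip_estimate d0 (\<lambda>i. h i \<omega>) u v)
        \<le> 1 / d0 * (u \<bullet> v) * (l1_norm u + l1_norm v)"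
proof -
  interpret prob_space M by fact
  note indep = \<open>prob_space.indep_vars M (\<lambda>_. borel) h UNIV\<close>
  have h[measurable]: "h i \<in> borel_measurable M" for i
    using indep unfolding indep_vars_def by auto
  define p where "p = keep_prob d0 u v"
  define c where "c i = u $ i * v $ i / p i" for i
  define A where "A i = {\<omega> \<in> space M. h i \<omega> \<le> p i}" for i
  \<comment> \<open>Each \<open>X i\<close> is written as a function of \<open>h i\<close> alone, so
    independence passes from \<open>h\<close> to \<open>X\<close> by composition. On the sample
    space it agrees with the scaled indicator of \<open>A i\<close>, which supplies the
    moments.\<close>
  define X where "X i \<omega> = c i * indicator {..p i} (h i \<omega>)" for i \<omega>
  have A: "A i \<in> events" for i
    unfolding A_def by measurable
  have p_range: "0 \<le> p i" "p i \<le> 1" for i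
    using assms(3)[of i] assms(4)[of i] assms(2,5,6)
    by (auto simp: p_def keep_prob_le_1 intro: keep_prob_nonneg)
  have prob_A: "prob (A i) = p i" for i
    unfolding A_def using h assms(11) p_range by (rule prob_uniform_le)
  have X_eq: "X i \<omega> = c i * indicator (A i) \<omega>" if "\<omega> \<in> space M" for i \<omega>
    using that by (simp add: X_def A_def indicator_def)
  have expectation_cong: "expectation f = expectation g"
    if "\<And>\<omega>. \<omega> \<in> space M \<Longrightarrow> f \<omega> = g \<omega>" for f g :: "'a \<Rightarrow> real"
    using that by (rule Bochner_Integration.integral_cong[OF refl])
  have mean_X: "expectation (X i) = u $ i * v $ i" for i
  proof -
    have "expectation (X i) = c i * p i"
      using expectation_cong[OF X_eq] scaled_indicator_moments(1)[OF A] prob_A by simp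
    also have "\<dots> = u $ i * v $ i"
      \<comment> \<open>If an entry is 0, then \<open>c i = 0\<close> and both sides vanish, even
        though \<open>p i\<close> is then 0 as well. Otherwise \<open>p i\<close> is positive and
        cancels.\<close>
      using keep_prob_pos[OF assms(2,5,6), of i] assms(3)[of i] assms(4)[of i]
      by (cases "u $ i = 0 \<or> v $ i = 0") (auto simp: c_def p_def)
    finally show ?thesis .
  qed
  have var_X: "variance (X i) = (c i)\<^sup>2 * p i * (1 - p i)" for i
  proof -
    have "variance (X i) = variance (\<lambda>\<omega>. c i * indicator (A i) \<omega>)"
      \<comment> \<open>The mean also occurs inside the variance integrand, so it has to be
        rewritten together with \<open>X i\<close>.\<close>
      by (rule expectation_cong) (simp only: X_eq expectation_cong[OF X_eq])
    then show ?thesis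
      by (simp only: scaled_indicator_moments(2)[OF A] prob_A)
  qed
  have X_sq: "integrable M (\<lambda>\<omega>. (X i \<omega>)\<^sup>2)" for i
    using scaled_indicator_moments(3)[OF A, of "c i" i]
    by (rule iffD1[OF Bochner_Integration.integrable_cong, rotated -1]) (simp_all add: X_eq)
  have [measurable]: "X i \<in> borel_measurable M" for i
    unfolding X_def by measurable
  have X_int: "integrable M (X i)" for i
    by (rule square_integrable_imp_integrable) (use X_sq in auto)
  have indep_X: "indep_vars (\<lambda>_. borel) X UNIV"
    unfolding X_def by (rule indep_vars_compose2[OF indep]) measurable
  have W: "ip_estimate d0 (\<lambda>i. h i \<omega>) u v = (\<Sum>i\<in>UNIV. X i \<omega>)" if "\<omega> \<in> space M" for \<omega>
    using assms(9)[OF that] by (simp add: ip_estimate_eq_sum_indicator X_def c_def p_def)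
  have mean_W: "expectation (\<lambda>\<omega>. ip_estimate d0 (\<lambda>i. h i \<omega>) u v) = expectation (\<lambda>\<omega>. \<Sum>i\<in>UNIV. X i \<omega>)"
    by (rule expectation_cong) (rule W)
  have "variance (\<lambda>\<omega>. ip_estimate d0 (\<lambda>i. h i \<omega>) u v) = variance (\<lambda>\<omega>. \<Sum>i\<in>UNIV. X i \<omega>)"
    unfolding mean_W by (rule expectation_cong) (simp add: W)
  also have "\<dots> = (\<Sum>i\<in>UNIV. (c i)\<^sup>2 * p i * (1 - p i))"
    using variance_sum_indep_vars[OF finite indep_X X_sq] by (simp add: var_X)
  also have "\<dots> \<le> (\<Sum>i\<in>UNIV. 1 / d0 * (u $ i * v $ i) * (l1_norm u + l1_norm v))"
    \<comment> \<open>Independence has removed all covariances, so the bound can be applied one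
      coordinate at a time.\<close>
    unfolding c_def p_def by (intro sum_mono coordinate_variance_bound assms)
  also have "\<dots> = 1 / d0 * (u \<bullet> v) * (l1_norm u + l1_norm v)"
    by (simp add: inner_vec_def sum_distrib_left sum_distrib_right sum_divide_distrib)
  finally have "variance (\<lambda>\<omega>. ip_estimate d0 (\<lambda>i. h i \<omega>) u v)
      \<le> 1 / d0 * (u \<bullet> v) * (l1_norm u + l1_norm v)" .
  moreover have "expectation (\<lambda>\<omega>. ip_estimate d0 (\<lambda>i. h i \<omega>) u v) = u \<bullet> v"
    unfolding mean_W using X_int by (simp add: mean_X inner_vec_def)
  ultimately show ?thesis by simp
qed

end
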